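(* For every integer $k\geq 0$ there exists a connected bipartite graph $G_k$ of order $2k+9$ such that: (1) $h(G_k)>\left\lceil\frac{n(G_k)}{2}\right\rceil=\alpha(G_k)$; (2) every $S\in\Omega(G_k)$ is a maximal annihilating set.
   Context: Graphs are finite, undirected, without loops or multiple edges. $n(G)=|V(G)|$ is the order and $m(G)=|E(G)|$. $\alpha(G)$ is the maximum size of an independent set of $G$, and $\Omega(G)$ is the family of all independent sets of size $\alpha(G)$. If $d_1\leq d_2\leq\cdots\leq d_n$ is the degree sequence of $G$, the annihilation number $h(G)$ is the largest integer $k$ (with $0\le k\le n$) such that $\sum_{i=1}^{k} d_i\leq m(G)$. For $A\subseteq V(G)$ let $\deg(A)=\sum_{v\in A}\deg(v)$. A set $A\subseteq V(G)$ is an annihilating set if $\deg(A)\leq m(G)$; an annihilating set $A$ is maximal if $\deg(A\cup\{v\})>m(G)$ for every $v\in V(G)-A$. *)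

theory Defs
  imports "Graph_Theory.Digraph_Component" "HOL-Library.Multiset"
begin

text \<open>
  A finite simple undirected graph is a \<^const>\<open>pair_graph\<close>: a finite loop-free digraph with
  a symmetric arc relation on vertex pairs. Each undirected edge \<open>{u, v}\<close> is therefore
  represented by the two arcs \<open>(u, v)\<close> and \<open>(v, u)\<close>, so \<open>m(G)\<close> counts
  unordered pairs and the degree of a vertex is its out-degree.
\<close>

definition order :: "'a pair_pre_digraph \<Rightarrow> nat" where
  "order G = card (pverts G)"

definition edges :: "'a pair_pre_digraph \<Rightarrow> 'a set set" where
  "edges G = {{u, v} | u v. (u, v) \<in> parcs G}"

definition num_edges :: "'a pair_pre_digraph \<Rightarrow> nat" where
  "num_edges G = card (edges G)"

definition degree :: "'a pair_pre_digraph \<Rightarrow> 'a \<Rightarrow> nat" where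
  "degree G v = out_degree (with_proj G) v"

definition bipartite :: "'a pair_pre_digraph \<Rightarrow> bool" where
  "bipartite G \<longleftrightarrow> (\<exists>A B. A \<union> B = pverts G \<and> A \<inter> B = {} \<and>
     (\<forall>(u, v) \<in> parcs G. (u \<in> A \<and> v \<in> B) \<or> (u \<in> B \<and> v \<in> A)))"

definition independent_set :: "'a pair_pre_digraph \<Rightarrow> 'a set \<Rightarrow> bool" where
  "independent_set G S \<longleftrightarrow> S \<subseteq> pverts G \<and> (\<forall>u\<in>S. \<forall>v\<in>S. (u, v) \<notin> parcs G)"

definition independence_number :: "'a pair_pre_digraph \<Rightarrow> nat" where
  "independence_number G = Max (card ` {S. independent_set G S})"

definition max_independent_sets :: "'a pair_pre_digraph \<Rightarrow> 'a set set" where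
  "max_independent_sets G = {S. independent_set G S \<and> card S = independence_number G}"

definition degree_sequence :: "'a pair_pre_digraph \<Rightarrow> nat list" where
  "degree_sequence G = sorted_list_of_multiset (image_mset (degree G) (mset_set (pverts G)))"

definition annihilation_number :: "'a pair_pre_digraph \<Rightarrow> nat" where
  "annihilation_number G =
     Max {k. k \<le> order G \<and> sum_list (take k (degree_sequence G)) \<le> num_edges G}"

definition degree_sum :: "'a pair_pre_digraph \<Rightarrow> 'a set \<Rightarrow> nat" where
  "degree_sum G A = (\<Sum>v\<in>A. degree G v)"

definition annihilating_set :: "'a pair_pre_digraph \<Rightarrow> 'a set \<Rightarrow> bool" where
  "annihilating_set G A \<longleftrightarrow> A \<subseteq> pverts G \<and> degree_sum G A \<le> num_edges G"

definition maximal_annihilating_set :: "'a pair_pre_digraph \<Rightarrow> 'a set \<Rightarrow> bool" where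
  "maximal_annihilating_set G A \<longleftrightarrow> annihilating_set G A \<and>
     (\<forall>v \<in> pverts G - A. degree_sum G (A \<union> {v}) > num_edges G)"

end

theory Submission
  imports Defs
begin

text \<open>
  The graph \<open>G\<^sub>k\<close> is bipartite with parts \<open>A\<close> of size \<open>k + 5\<close> and \<open>B\<close> of size \<open>k + 4\<close>. All
  vertices of \<open>B\<close> but two are joined to the whole of \<open>A\<close>; the remaining two have degree \<open>2\<close>,
  with neighbourhoods \<open>{0, 1}\<close> and \<open>{0, 2}\<close> for three distinct vertices \<open>0, 1, 2\<close> of \<open>A\<close>.

  Summing degrees over one part of a bipartite graph counts every edge once, so
  \<open>deg(A) = m(G)\<close>. Hence \<open>A\<close> is annihilating, and it is maximal with this property because no
  vertex outside of \<open>A\<close> is isolated (\<open>part_maximal_annihilating\<close>).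

  Every nonempty set of vertices of \<open>B\<close> has strictly more neighbours than members, so
  exchanging a subset of \<open>A\<close> for vertices of \<open>B\<close> always loses: \<open>A\<close> is the only maximum
  independent set (\<open>card_independent_less\<close>). Thus \<open>\<alpha>(G) = k + 5 = \<lceil>(2k + 9) / 2\<rceil>\<close>, and the
  condition on maximum independent sets concerns \<open>A\<close> alone.

  The annihilation number exceeds \<open>k + 5\<close> because it ignores adjacency. The vertex \<open>0\<close> is
  adjacent to all of \<open>B\<close>, so it has degree \<open>k + 4 \<ge> 2 + 2\<close>. Replacing it in \<open>A\<close> by both vertices
  of degree \<open>2\<close> gives \<open>k + 6\<close> vertices with degree sum \<open>m(G) - (k + 4) + 4 \<le> m(G)\<close>, and the
  \<open>k + 6\<close> smallest degrees sum to no more than that (\<open>annihilating_set_card_le\<close>).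
\<close>

section \<open>Annihilating sets and the annihilation number\<close>

text \<open>
  The least element of a sorted list can be exchanged for any element of the multiset without
  increasing its sum; iterating this along the list gives the bound.
\<close>

lemma sum_take_sorted_le_sum_submset:
  fixes xs :: "nat list"
  assumes "sorted xs" and "M \<subseteq># mset xs"
  shows "sum_list (take (size M) xs) \<le> sum_mset M"
  using assms
proof (induction xs arbitrary: M)
  case Nil
  then show ?case by simp
next
  case (Cons x xs)
  show ?case
  proof (cases "M = {#}")
    case True
    then show ?thesis by simp
  next
    case False
    obtain y where y: "y \<in># M" "x \<le> y" "M - {#y#} \<subseteq># mset xs"
    proof (cases "x \<in># M")
      case True
      then show ?thesis
        using Cons.prems(2) that[of x] by (simp add: subset_eq_diff_conv)
    next
      case False
      from \<open>M \<noteq> {#}\<close> obtain y where "y \<in># M" by blast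
      moreover have "M \<subseteq># mset xs"
        using Cons.prems(2) False by (simp add: inter_add_left1 subset_mset.inf.absorb_iff2 inf_commute)
      moreover from this have "x \<le> y"
        using Cons.prems(1) \<open>y \<in># M\<close> by (auto dest: mset_subset_eqD)
      ultimately show ?thesis
        using that[of y] by (meson diff_subset_eq_self subset_mset.order_trans)
    qed
    have size: "size M = Suc (size (M - {#y#}))"
      using y(1) by (metis Suc_pred' nonempty_has_size False size_Diff_singleton)
    have "sum_list (take (size M) (x # xs)) \<le> y + sum_mset (M - {#y#})"
      using Cons y unfolding size by (auto intro: add_mono)
    also have "\<dots> = sum_mset M"
      using y(1) by (simp add: sum_mset.remove)
    finally show ?thesis .
  qed
qed

lemma annihilating_set_card_le:
  assumes fin: "finite (pverts G)" and T: "annihilating_set G T"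
  shows "card T \<le> annihilation_number G"
proof -
  let ?M = "image_mset (degree G) (mset_set T)"
  from T have sub: "T \<subseteq> pverts G" and sum: "degree_sum G T \<le> num_edges G"
    by (auto simp: annihilating_set_def)
  have "?M \<subseteq># mset (degree_sequence G)"
    using fin sub unfolding degree_sequence_def
    by (simp add: image_mset_subseteq_mono subset_imp_msubset_mset_set)
  then have "sum_list (take (size ?M) (degree_sequence G)) \<le> sum_mset ?M"
    by (intro sum_take_sorted_le_sum_submset) (auto simp: degree_sequence_def)
  then have "sum_list (take (card T) (degree_sequence G)) \<le> num_edges G"
    using sum by (simp add: degree_sum_def sum_unfold_sum_mset)
  moreover have "card T \<le> order G"
    unfolding order_def using fin sub by (rule card_mono)
  ultimately show ?thesis
    unfolding annihilation_number_def by (intro Max_ge) auto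
qed

lemma
  assumes fin: "finite (pverts G)" and A: "independent_set G A"
    and less: "\<And>S. independent_set G S \<Longrightarrow> S \<noteq> A \<Longrightarrow> card S < card A"
  shows independence_number_unique: "independence_number G = card A"
    and max_independent_sets_unique: "max_independent_sets G = {A}"
proof -
  have "finite {S. independent_set G S}"
    by (rule finite_subset[of _ "Pow (pverts G)"]) (auto simp: independent_set_def fin)
  then show num: "independence_number G = card A"
    unfolding independence_number_def using A less by (intro Max_eqI) (auto intro: less_imp_le)
  show "max_independent_sets G = {A}"
    unfolding max_independent_sets_def num using A less by fastforce
qed

section \<open>Graphs given by a bipartition\<close>

locale bigraph =
  fixes A B :: "'a set" and E :: "('a \<times> 'a) set"
  assumes finite_A: "finite A" and finite_B: "finite B"
    and disjoint: "A \<inter> B = {}" and E_sub: "E \<subseteq> A \<times> B"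
begin

definition G :: "'a pair_pre_digraph" where
  "G = \<lparr>pverts = A \<union> B, parcs = E \<union> E\<inverse>\<rparr>"

lemma G_simps [simp]: "pverts G = A \<union> B" "parcs G = E \<union> E\<inverse>"
  by (simp_all add: G_def)

lemma finite_E: "finite E"
  using E_sub finite_A finite_B by (meson finite_SigmaI finite_subset)

lemma pair_graph_G: "pair_graph G"
proof
  show "finite (parcs G)" using finite_E by simp
  show "symmetric (with_proj G)" by (auto simp: symmetric_def intro: symI)
qed (use E_sub disjoint finite_A finite_B in auto)

lemma bipartite_G: "bipartite G"
  unfolding bipartite_def
  by (rule exI[of _ A], rule exI[of _ B]) (use E_sub disjoint in auto)

lemma order_G: "order G = card A + card B"
  by (simp add: order_def card_Un_disjoint finite_A finite_B disjoint)

lemma num_edges_G: "num_edges G = card E"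
proof -
  have "edges G = (\<lambda>(u, v). {u, v}) ` E"
    by (auto simp: edges_def image_iff insert_commute)
  moreover have "(v, u) \<notin> E" if "(u, v) \<in> E" for u v
    using that E_sub disjoint by blast
  then have "inj_on (\<lambda>(u, v). {u, v}) E"
    by (auto simp: inj_on_def doubleton_eq_iff)
  ultimately show ?thesis by (simp add: num_edges_def card_image)
qed

lemma degree_left:
  assumes "a \<in> A"
  shows "degree G a = card (E `` {a})"
proof -
  have "out_arcs (with_proj G) a = Pair a ` (E `` {a})"
    using assms E_sub disjoint by (auto simp: out_arcs_def)
  then show ?thesis
    by (simp add: degree_def out_degree_def card_image inj_on_def)
qed

lemma degree_right:
  assumes "b \<in> B"
  shows "degree G b = card (E\<inverse> `` {b})"
proof -
  have "out_arcs (with_proj G) b = Pair b ` (E\<inverse> `` {b})"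
    using assms E_sub disjoint by (auto simp: out_arcs_def)
  then show ?thesis
    by (simp add: degree_def out_degree_def card_image inj_on_def)
qed

text \<open>Each edge has exactly one end in \<open>A\<close>, so it is counted once.\<close>

lemma degree_sum_part: "degree_sum G A = num_edges G"
proof -
  have "E = (SIGMA a:A. E `` {a})"
    using E_sub by auto
  then have "card E = (\<Sum>a\<in>A. card (E `` {a}))"
    using finite_A finite_E
    by (metis card_SigmaI finite_Image)
  then show ?thesis
    by (simp add: degree_sum_def num_edges_G degree_left)
qed

lemma part_independent: "independent_set G A"
  using E_sub disjoint by (auto simp: independent_set_def)

lemma part_maximal_annihilating:
  assumes "\<And>b. b \<in> B \<Longrightarrow> \<exists>a. (a, b) \<in> E"
  shows "maximal_annihilating_set G A"
proof -
  have "degree_sum G (A \<union> {b}) > num_edges G" if "b \<in> B" "b \<notin> A" for b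
  proof -
    have "finite (E\<inverse> `` {b})"
      using finite_E by (simp add: finite_Image)
    then have "degree G b > 0"
      using assms[OF that(1)] by (auto simp: degree_right[OF that(1)] card_gt_0_iff)
    moreover have "degree_sum G (A \<union> {b}) = degree_sum G A + degree G b"
      using finite_A that(2) by (simp add: degree_sum_def)
    ultimately show ?thesis using degree_sum_part by simp
  qed
  then show ?thesis
    by (auto simp: maximal_annihilating_set_def annihilating_set_def degree_sum_part)
qed

text \<open>
  All of \<open>B\<close> is one step away from \<open>a\<close>, and all of \<open>A\<close> is one step away from \<open>b\<close>, which is itself
  adjacent to \<open>a\<close>. So every vertex is within two steps of \<open>a\<close>.
\<close>

lemma connected_G:
  assumes a: "a \<in> A" "\<And>y. y \<in> B \<Longrightarrow> (a, y) \<in> E"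
    and b: "b \<in> B" "\<And>x. x \<in> A \<Longrightarrow> (x, b) \<in> E"
  shows "connected (with_proj G)"
proof -
  interpret pair_graph G by (rule pair_graph_G)
  have ab: "a \<rightarrow>\<^sup>*\<^bsub>G\<^esub> b"
    using a b by (intro reachable_adjI) simp
  have to_a: "a \<rightarrow>\<^sup>*\<^bsub>G\<^esub> v" if "v \<in> A \<union> B" for v
  proof (cases "v \<in> B")
    case True
    then show ?thesis using a by (intro reachable_adjI) simp
  next
    case False
    then have "b \<rightarrow>\<^sup>*\<^bsub>G\<^esub> v" using that b by (intro reachable_adjI) simp
    with ab show ?thesis by (rule reachable_trans)
  qed
  show ?thesis
    unfolding connected_def
  proof (rule strongly_connectedI)
    show "verts (mk_symmetric G) \<noteq> {}" using a by auto
    fix u v assume "u \<in> verts (mk_symmetric G)" "v \<in> verts (mk_symmetric G)"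
    then have "a \<rightarrow>\<^sup>*\<^bsub>G\<^esub> u" "a \<rightarrow>\<^sup>*\<^bsub>G\<^esub> v" using to_a by auto
    then have "u \<rightarrow>\<^sup>*\<^bsub>G\<^esub> v"
      by (meson symmetric_reachable' reachable_trans)
    then show "u \<rightarrow>\<^sup>*\<^bsub>with_proj (mk_symmetric G)\<^esub> v"
      by (rule reachable_mk_symmetricI)
  qed
qed

end

section \<open>The graphs \<open>G\<^sub>k\<close>\<close>

definition big_part :: "nat \<Rightarrow> nat set" where
  "big_part k = {..<k + 5}"

definition small_part :: "nat \<Rightarrow> nat set" where
  "small_part k = {k + 5..<2 * k + 9}"

text \<open>The vertices \<open>k + 5\<close> and \<open>k + 6\<close> are the two of degree \<open>2\<close>.\<close>

definition links :: "nat \<Rightarrow> (nat \<times> nat) set" where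
  "links k = {(0, k + 5), (1, k + 5), (0, k + 6), (2, k + 6)} \<union>
     big_part k \<times> {k + 7..<2 * k + 9}"

interpretation Gk: bigraph "big_part k" "small_part k" "links k" for k
  by unfold_locales (auto simp: big_part_def small_part_def links_def)

lemma card_parts: "card (big_part k) = k + 5" "card (small_part k) = k + 4"
  by (simp_all add: big_part_def small_part_def)

text \<open>
  A set containing a vertex joined to all of \<open>A\<close> lies inside the smaller part. Any other one
  is a subset of \<open>A\<close>, or arises from such a subset by inserting one or both of the vertices of
  degree \<open>2\<close>, which forces out two or three vertices of \<open>A\<close> respectively.
\<close>

lemma card_independent_less:
  assumes S: "independent_set (Gk.G k) S" and ne: "S \<noteq> big_part k"
  shows "card S < card (big_part k)"
proof -
  have sub: "S \<subseteq> big_part k \<union> small_part k"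
    and ind: "\<And>u v. (u, v) \<in> links k \<Longrightarrow> u \<in> S \<Longrightarrow> v \<notin> S"
    using S by (auto simp: independent_set_def)
  have bound: "card S < k + 5" if "S \<subseteq> T" "finite T" "card T = k + 4" for T
    using card_mono[OF that(2,1)] that(3) by simp
  have "card S < k + 5"
  proof (cases "\<exists>b \<in> S. b \<ge> k + 7")
    case True
    then obtain b where "b \<in> S" "b \<ge> k + 7" by blast
    then have "u \<notin> S" if "u \<in> big_part k" for u
      using ind[of u b] that sub by (auto simp: links_def small_part_def big_part_def)
    with sub have "S \<subseteq> small_part k" by auto
    then show ?thesis by (rule bound) (auto simp: small_part_def)
  next
    case False
    have sub': "S \<subseteq> big_part k \<union> {k + 5, k + 6}"
    proof
      fix v assume "v \<in> S"
      with False have "v < k + 7" by (meson not_le)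
      then show "v \<in> big_part k \<union> {k + 5, k + 6}" by (auto simp: big_part_def)
    qed
    have 5: "0 \<notin> S \<and> 1 \<notin> S" if "k + 5 \<in> S"
      using ind[of _ "k + 5"] that by (auto simp: links_def)
    have 6: "0 \<notin> S \<and> 2 \<notin> S" if "k + 6 \<in> S"
      using ind[of _ "k + 6"] that by (auto simp: links_def)
    consider (both) "k + 5 \<in> S" "k + 6 \<in> S" | (first) "k + 5 \<in> S" "k + 6 \<notin> S"
      | (second) "k + 5 \<notin> S" "k + 6 \<in> S" | (none) "k + 5 \<notin> S" "k + 6 \<notin> S"
      by blast
    then show ?thesis
    proof cases
      case both
      have "S \<subseteq> (big_part k - {0, 1, 2}) \<union> {k + 5, k + 6}" using sub' 5 6 both by auto
      then show ?thesis
        by (rule bound) (auto simp: big_part_def card_Diff_subset card_insert_if)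
    next
      case first
      have "S \<subseteq> (big_part k - {0, 1}) \<union> {k + 5}" using sub' 5 first by auto
      then show ?thesis
        by (rule bound) (auto simp: big_part_def card_Diff_subset card_insert_if)
    next
      case second
      have "S \<subseteq> (big_part k - {0, 2}) \<union> {k + 6}" using sub' 6 second by auto
      then show ?thesis
        by (rule bound) (auto simp: big_part_def card_Diff_subset card_insert_if)
    next
      case none
      with sub' ne have "S \<subset> big_part k" by auto
      then show ?thesis
        using psubset_card_mono[of "big_part k" S] by (simp add: big_part_def)
    qed
  qed
  then show ?thesis by (simp add: big_part_def)
qed

lemma annihilation_number_Gk: "k + 6 \<le> annihilation_number (Gk.G k)"
proof -
  let ?G = "Gk.G k"
  let ?T = "insert (k + 5) (insert (k + 6) (big_part k - {0}))"
  have "links k `` {0} = small_part k" "(links k)\<inverse> `` {k + 5} = {0, 1}"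
    "(links k)\<inverse> `` {k + 6} = {0, 2}"
    by (auto simp: links_def big_part_def small_part_def)
  moreover have mem: "0 \<in> big_part k" "k + 5 \<in> small_part k" "k + 6 \<in> small_part k"
    by (auto simp: big_part_def small_part_def)
  ultimately have deg: "degree ?G 0 = k + 4" "degree ?G (k + 5) = 2" "degree ?G (k + 6) = 2"
    using card_parts(2)[of k] by (simp_all add: Gk.degree_left Gk.degree_right)
  have "degree_sum ?G (big_part k) = degree ?G 0 + degree_sum ?G (big_part k - {0})"
    unfolding degree_sum_def by (rule sum.remove) (auto simp: big_part_def)
  moreover have "degree_sum ?G ?T = 4 + degree_sum ?G (big_part k - {0})"
    using deg by (simp add: degree_sum_def big_part_def)
  ultimately have "degree_sum ?G ?T \<le> num_edges ?G"
    using deg(1) by (simp add: Gk.degree_sum_part)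
  then have "annihilating_set ?G ?T"
    using mem by (auto simp: annihilating_set_def)
  then have "card ?T \<le> annihilation_number ?G"
    by (intro annihilating_set_card_le) (simp_all add: Gk.finite_A Gk.finite_B)
  moreover have "card ?T = k + 6"
    by (simp add: big_part_def)
  ultimately show ?thesis by simp
qed

theorem theorem4p4:
  shows "\<forall>k::nat. \<exists>G :: nat pair_pre_digraph.
    pair_graph G \<and> connected (with_proj G) \<and> bipartite G \<and> order G = 2 * k + 9 \<and>
    int (annihilation_number G) > \<lceil>real (order G) / 2\<rceil> \<and>
    \<lceil>real (order G) / 2\<rceil> = int (independence_number G) \<and>
    (\<forall>S \<in> max_independent_sets G. maximal_annihilating_set G S)"
proof (intro allI exI conjI)
  fix k :: nat
  let ?G = "Gk.G k"
  have fin: "finite (pverts ?G)"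
    by (simp add: Gk.finite_A Gk.finite_B)
  note unique = fin Gk.part_independent card_independent_less
  show order: "order ?G = 2 * k + 9"
    by (simp add: Gk.order_G card_parts)
  have half: "\<lceil>real (order ?G) / 2\<rceil> = int k + 5"
    unfolding order by (rule ceiling_unique) auto
  show "pair_graph ?G" by (rule Gk.pair_graph_G)
  show "bipartite ?G" by (rule Gk.bipartite_G)
  show "connected (with_proj ?G)"
    by (rule Gk.connected_G[of 0 _ "k + 7"]) (auto simp: big_part_def small_part_def links_def)
  show "int (annihilation_number ?G) > \<lceil>real (order ?G) / 2\<rceil>"
    using annihilation_number_Gk[of k] half by simp
  show "\<lceil>real (order ?G) / 2\<rceil> = int (independence_number ?G)"
    using independence_number_unique[OF unique] half by (simp add: card_parts)
  have "\<exists>a. (a, b) \<in> links k" if "b \<in> small_part k" for b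
    using that by (intro exI[of _ 0]) (auto simp: links_def small_part_def big_part_def)
  then show "\<forall>S \<in> max_independent_sets ?G. maximal_annihilating_set ?G S"
    using max_independent_sets_unique[OF unique] Gk.part_maximal_annihilating by simp
qed

end
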